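(* Let $$\Lambda=\begin{bmatrix}0&1&1&0&0\\1&0&1&1&0\\1&1&0&1&1\\0&1&1&0&1\\0&0&1&1&0\end{bmatrix}.$$ Then the total Milnor quotient $\mathcal{M}(\Lambda)$ is the trivial group.
   Context: A linking matrix is a symmetric $n\times n$ matrix $\Lambda=(\Lambda_{ij})$ with integer entries and zeros on the main diagonal. Let $e_1,\dots,e_n$ be the standard basis of $\mathbb{Z}^n$ and, for $1\le i,j,k\le n$, put $X^{ijk}=e_i\wedge e_j\wedge e_k\in \mathbb{Z}^n\wedge\mathbb{Z}^n\wedge\mathbb{Z}^n$ (third exterior power). Thus $X^{ijk}=0$ if two of the indices coincide, $X^{ijk}=X^{jki}=X^{kij}=-X^{ikj}=-X^{jik}=-X^{kji}$, and $\{X^{ijk}:1\le i<j<k\le n\}$ is a basis, giving an identification with $\mathbb{Z}^{\binom n3}$. For $1\le j\ne k\le n$ let $v_{jk}=\sum_{i=1}^n \Lambda_{ik}X^{ijk}$, and let $V(\Lambda)\subseteq\mathbb{Z}^{\binom n3}$ be the subgroup generated by all $v_{jk}$, $1\le j\neq k\le n$. The total Milnor quotient associated with $\Lambda$ is the abelian group $\mathcal{M}(\Lambda)=\mathbb{Z}^{\binom n3}/V(\Lambda)$. *)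

theory Defs
  imports
    "HOL-Algebra.Free_Abelian_Groups"
    "HOL-Algebra.Elementary_Groups"
    "Jordan_Normal_Form.Matrix"
begin

(* Rows and columns of matrices are indexed from 0, so the indices 1, ..., n of the
   mathematical text become 0, ..., n - 1 throughout. *)

definition linking_matrix :: "int mat \<Rightarrow> bool" where
  "linking_matrix \<Lambda> \<longleftrightarrow>
     square_mat \<Lambda> \<and> transpose_mat \<Lambda> = \<Lambda> \<and> (\<forall>i<dim_row \<Lambda>. \<Lambda> $$ (i, i) = 0)"

definition triples :: "nat \<Rightarrow> (nat \<times> nat \<times> nat) set" where
  "triples n = {(a, b, c). a < b \<and> b < c \<and> c < n}"

(* The third exterior power of Z^n, identified with Z^(n choose 3): the basis vector
   frag_of (a, b, c) stands for the wedge of e_a, e_b, e_c with a < b < c. *)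
definition ext_cube :: "nat \<Rightarrow> ((nat \<times> nat \<times> nat) \<Rightarrow>\<^sub>0 int) monoid" where
  "ext_cube n = free_Abelian_group (triples n)"

(* The coordinates of u \<and> v \<and> w are the 3 x 3 minors of the matrix with rows u, v, w. *)
definition minor3 :: "int vec \<Rightarrow> int vec \<Rightarrow> int vec \<Rightarrow> nat \<times> nat \<times> nat \<Rightarrow> int" where
  "minor3 u v w = (\<lambda>(a, b, c).
       u $ a * (v $ b * w $ c - v $ c * w $ b)
     - u $ b * (v $ a * w $ c - v $ c * w $ a)
     + u $ c * (v $ a * w $ b - v $ b * w $ a))"

definition wedge3 :: "nat \<Rightarrow> int vec \<Rightarrow> int vec \<Rightarrow> int vec \<Rightarrow> (nat \<times> nat \<times> nat) \<Rightarrow>\<^sub>0 int" where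
  "wedge3 n u v w = (\<Sum>t\<in>triples n. frag_cmul (minor3 u v w t) (frag_of t))"

definition X :: "nat \<Rightarrow> nat \<Rightarrow> nat \<Rightarrow> nat \<Rightarrow> (nat \<times> nat \<times> nat) \<Rightarrow>\<^sub>0 int" where
  "X n i j k = wedge3 n (unit_vec n i) (unit_vec n j) (unit_vec n k)"

definition milnor_vec :: "int mat \<Rightarrow> nat \<Rightarrow> nat \<Rightarrow> (nat \<times> nat \<times> nat) \<Rightarrow>\<^sub>0 int" where
  "milnor_vec \<Lambda> j k =
     (\<Sum>i<dim_row \<Lambda>. frag_cmul (\<Lambda> $$ (i, k)) (X (dim_row \<Lambda>) i j k))"

definition milnor_subgroup :: "int mat \<Rightarrow> ((nat \<times> nat \<times> nat) \<Rightarrow>\<^sub>0 int) set" where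
  "milnor_subgroup \<Lambda> = generate (ext_cube (dim_row \<Lambda>))
     {milnor_vec \<Lambda> j k | j k. j < dim_row \<Lambda> \<and> k < dim_row \<Lambda> \<and> j \<noteq> k}"

definition total_milnor_quotient :: "int mat \<Rightarrow> ((nat \<times> nat \<times> nat) \<Rightarrow>\<^sub>0 int) set monoid" where
  "total_milnor_quotient \<Lambda> = ext_cube (dim_row \<Lambda>) Mod milnor_subgroup \<Lambda>"


lemma linking_matrix_example:
  "linking_matrix (mat_of_rows_list 5
    [[0, 1, 1, 0, 0],
     [1, 0, 1, 1, 0],
     [1, 1, 0, 1, 1],
     [0, 1, 1, 0, 1],
     [0, 0, 1, 1, 0]])"
  unfolding linking_matrix_def
  by (auto simp: mat_of_rows_list_def mat_eq_iff numeral_eq_Suc less_Suc_eq)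

text \<open>The wedge product is trilinear and alternating, and the wedges of the standard basis
  vectors with increasing indices form the basis of \<^const>\<open>ext_cube\<close>.\<close>

lemma finite_triples [simp]: "finite (triples n)"
  by (rule finite_subset[of _ "{..<n} \<times> {..<n} \<times> {..<n}"]) (auto simp: triples_def)

lemma lookup_wedge3:
  "Poly_Mapping.lookup (wedge3 n u v w) t = (if t \<in> triples n then minor3 u v w t else 0)"
proof -
  have "Poly_Mapping.lookup (wedge3 n u v w) t
      = (\<Sum>s\<in>triples n. minor3 u v w s * (if t = s then 1 else 0))"
    unfolding wedge3_def
    by (simp add: lookup_sum lookup_single when_def)
  also have "\<dots> = (if t \<in> triples n then minor3 u v w t else 0)"
    by (simp add: if_distrib cong: if_cong)
  finally show ?thesis .
qed

lemma wedge3_closed: "wedge3 n u v w \<in> carrier (ext_cube n)"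
  by (auto simp: ext_cube_def free_Abelian_group_def in_keys_iff lookup_wedge3 split: if_splits)

lemma wedge3_add:
  assumes "u \<in> carrier_vec n" "u' \<in> carrier_vec n"
  shows "wedge3 n (u + u') v w = wedge3 n u v w + wedge3 n u' v w"
  using assms
  by (intro poly_mapping_eqI) (auto simp: lookup_wedge3 lookup_add minor3_def triples_def algebra_simps)

lemma wedge3_smult:
  assumes "u \<in> carrier_vec n"
  shows "wedge3 n (c \<cdot>\<^sub>v u) v w = frag_cmul c (wedge3 n u v w)"
  using assms
  by (intro poly_mapping_eqI) (auto simp: lookup_wedge3 minor3_def triples_def algebra_simps)

lemma wedge3_swap:
  "wedge3 n v u w = - wedge3 n u v w"
  "wedge3 n u w v = - wedge3 n u v w"
  by (intro poly_mapping_eqI; auto simp: lookup_wedge3 minor3_def algebra_simps)+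

lemma wedge3_same:
  "wedge3 n u u w = 0" "wedge3 n u v u = 0" "wedge3 n u v v = 0"
  by (intro poly_mapping_eqI; auto simp: lookup_wedge3 minor3_def algebra_simps)+

lemma X_eq_0: "i = j \<or> j = k \<or> i = k \<Longrightarrow> X n i j k = 0"
  by (auto simp: X_def wedge3_same)

lemma X_perm:
  "X n j k i = X n i j k" "X n k i j = X n i j k"
  "X n i k j = - X n i j k" "X n j i k = - X n i j k" "X n k j i = - X n i j k"
  unfolding X_def
  by (intro poly_mapping_eqI; auto simp: lookup_wedge3 minor3_def algebra_simps)+

lemma X_basis:
  assumes "i < j" "j < k" "k < n"
  shows "X n i j k = frag_of (i, j, k)"
  using assms
  by (intro poly_mapping_eqI)
     (auto simp: X_def lookup_wedge3 lookup_single when_def minor3_def triples_def unit_vec_def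
      split: if_splits)

lemma comm_group_total_milnor_quotient: "comm_group (total_milnor_quotient \<Lambda>)"
proof -
  define n where "n = dim_row \<Lambda>"
  interpret comm_group "ext_cube n"
    by (simp add: ext_cube_def abelian_free_Abelian_group)
  have "Poly_Mapping.keys (wedge3 n u v w) \<subseteq> triples n" for u v w
    using wedge3_closed by (simp add: ext_cube_def)
  then have "milnor_vec \<Lambda> j k \<in> carrier (ext_cube n)" for j k
    unfolding milnor_vec_def X_def n_def[symmetric] ext_cube_def
    by (intro sum_closed_free_Abelian_group) (meson carrier_free_Abelian_group_iff keys_cmul order_trans)
  then have "subgroup (milnor_subgroup \<Lambda>) (ext_cube n)"
    unfolding milnor_subgroup_def n_def[symmetric] by (intro generate_is_subgroup) auto
  then show ?thesis
    unfolding total_milnor_quotient_def n_def[symmetric] by (rule abelian_FactGroup)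
qed

end

theory Submission
  imports Defs
begin

text \<open>
  View \<open>\<Lambda>\<close> as the adjacency matrix of the graph on \<open>0, \<dots>, 4\<close> with edges
  \<open>01, 02, 12, 13, 23, 24, 34\<close>, a strip of the three triangles \<open>012\<close>, \<open>123\<close>, \<open>234\<close>. Write
  \<open>abc\<close> also for the basis vector of the increasing triple \<open>a < b < c\<close>. The generator indexed by
  \<open>(j, k)\<close> is the sum of the \<open>X\<^sup>i\<^sup>j\<^sup>k\<close> over the neighbours \<open>i\<close> of \<open>k\<close>, where \<open>i = j\<close>
  contributes nothing. The end vertices \<open>0\<close> and \<open>4\<close> have only two neighbours, so taking \<open>k\<close> to be
  one of them and \<open>j\<close> one of its neighbours leaves a single term: the outer triangles \<open>012\<close> and
  \<open>234\<close> lie in the subgroup.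

  From there the relations can be solved by substitution over the integers, since at each stage
  some generator involves exactly one basis vector not yet obtained, with coefficient \<open>\<plusminus>1\<close>.
  In this way \<open>(0, 1)\<close> gives \<open>013\<close>, \<open>(3, 0)\<close> gives \<open>023\<close>, \<open>(2, 1)\<close> gives \<open>123\<close>, \<open>(1, 3)\<close> gives
  \<open>134\<close>, \<open>(1, 4)\<close> gives \<open>124\<close>, \<open>(4, 1)\<close> gives \<open>014\<close>, \<open>(4, 0)\<close> gives \<open>024\<close> and \<open>(0, 4)\<close> gives
  \<open>034\<close>. So all ten basis vectors lie in the subgroup, which is therefore the whole group
  (\<open>trivial_total_milnor_quotientI\<close>). The signs come from sorting the indices of \<open>X\<close>
  (\<open>X_sorted\<close>).
\<close>

text \<open>Sorting the indices puts \<open>X\<close> into normal form, so that for numerical indices the simplifier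
  can expand a generator in the basis.\<close>

lemma X_sorted:
  assumes "i < n" "j < n" "k < n"
  shows "X n i j k =
    (if i < j \<and> j < k then frag_of (i, j, k)
     else if j < k \<and> k < i then frag_of (j, k, i)
     else if k < i \<and> i < j then frag_of (k, i, j)
     else if i < k \<and> k < j then - frag_of (i, k, j)
     else if j < i \<and> i < k then - frag_of (j, i, k)
     else if k < j \<and> j < i then - frag_of (k, j, i)
     else 0)"
proof -
  consider "i = j \<or> j = k \<or> i = k" | "i < j" "j < k" | "j < k" "k < i" | "k < i" "i < j"
    | "i < k" "k < j" | "j < i" "i < k" | "k < j" "j < i"
    by linarith
  then show ?thesis
  proof cases
    case 1
    then show ?thesis by (auto simp: X_eq_0)
  next
    case 2
    then show ?thesis using assms by (simp add: X_basis)
  next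
    case 3
    then show ?thesis using assms X_perm(2)[of n i j k] by (simp add: X_basis)
  next
    case 4
    then show ?thesis using assms X_perm(1)[of n i j k] by (simp add: X_basis)
  next
    case 5
    then show ?thesis using assms X_perm(3)[of n i j k] by (simp add: X_basis)
  next
    case 6
    then show ?thesis using assms X_perm(4)[of n i j k] by (simp add: X_basis)
  next
    case 7
    then show ?thesis using assms X_perm(5)[of n i j k] by (simp add: X_basis)
  qed
qed

lemma milnor_vec_closed: "milnor_vec \<Lambda> j k \<in> carrier (ext_cube (dim_row \<Lambda>))"
proof -
  have "Poly_Mapping.keys (X n i j k) \<subseteq> triples n" for n i
    using wedge3_closed by (simp add: X_def ext_cube_def)
  then show ?thesis
    unfolding milnor_vec_def ext_cube_def
    by (intro sum_closed_free_Abelian_group)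
       (meson carrier_free_Abelian_group_iff keys_cmul order_trans)
qed

lemma subgroup_milnor_subgroup: "subgroup (milnor_subgroup \<Lambda>) (ext_cube (dim_row \<Lambda>))"
  unfolding milnor_subgroup_def
proof (rule group.generate_is_subgroup)
  show "group (ext_cube (dim_row \<Lambda>))"
    by (simp add: ext_cube_def)
qed (auto simp: milnor_vec_closed)

lemma milnor_vec_in_milnor_subgroup:
  "j < dim_row \<Lambda> \<Longrightarrow> k < dim_row \<Lambda> \<Longrightarrow> j \<noteq> k \<Longrightarrow> milnor_vec \<Lambda> j k \<in> milnor_subgroup \<Lambda>"
  unfolding milnor_subgroup_def by (rule generate.incl) auto

lemma subgroup_free_Abelian_group_minus:
  assumes "subgroup H (free_Abelian_group S)" "x \<in> H"
  shows "- x \<in> H"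
  using subgroup.m_inv_closed[OF assms] subgroup.mem_carrier[OF assms] by simp

lemma subgroup_free_Abelian_group_add:
  assumes "subgroup H (free_Abelian_group S)" "x \<in> H" "y \<in> H"
  shows "x + y \<in> H"
  using subgroup.m_closed[OF assms] by simp

lemma subgroup_free_Abelian_group_diff:
  assumes "subgroup H (free_Abelian_group S)" "x \<in> H" "y \<in> H"
  shows "x - y \<in> H"
  using subgroup_free_Abelian_group_add[OF assms(1,2) subgroup_free_Abelian_group_minus[OF assms(1,3)]]
  by simp

lemma subgroup_free_Abelian_group_eq_carrier:
  assumes H: "subgroup H (free_Abelian_group S)"
    and gens: "\<And>s. s \<in> S \<Longrightarrow> frag_of s \<in> H"
  shows "H = carrier (free_Abelian_group S)"
proof
  show "H \<subseteq> carrier (free_Abelian_group S)"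
    using H by (rule subgroup.subset)
  show "carrier (free_Abelian_group S) \<subseteq> H"
  proof
    fix x assume "x \<in> carrier (free_Abelian_group S)"
    then have "Poly_Mapping.keys x \<subseteq> S" by simp
    then show "x \<in> H"
    proof (induction x rule: frag_induction)
      case zero
      then show ?case using subgroup.one_closed[OF H] by simp
    next
      case (one s)
      then show ?case by (rule gens)
    next
      case (diff a b)
      then show ?case by (intro subgroup_free_Abelian_group_diff[OF H])
    qed
  qed
qed

lemma trivial_group_FactGroup_carrier:
  assumes "group G"
  shows "trivial_group (G Mod carrier G)"
proof -
  interpret group G by fact
  have "carrier G \<lhd> G"
    using normal_inv_iff subgroup_self by blast
  then have "group (G Mod carrier G)"
    by (rule normal.factorgroup_is_group)
  moreover have "(\<lambda>x. carrier G #>\<^bsub>G\<^esub> x) ` carrier G = (\<lambda>x. carrier G) ` carrier G"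
    by (intro image_cong refl coset_join2 subgroup_self)
  then have "carrier (G Mod carrier G) = {carrier G}"
    using carrier_not_empty by (simp add: carrier_FactGroup image_constant_conv)
  ultimately show ?thesis
    by (simp add: trivial_group_def)
qed

lemma trivial_total_milnor_quotientI:
  assumes "\<And>a b c. a < b \<Longrightarrow> b < c \<Longrightarrow> c < dim_row \<Lambda> \<Longrightarrow> frag_of (a, b, c) \<in> milnor_subgroup \<Lambda>"
  shows "trivial_group (total_milnor_quotient \<Lambda>)"
proof -
  have "milnor_subgroup \<Lambda> = carrier (ext_cube (dim_row \<Lambda>))"
    using subgroup_milnor_subgroup assms unfolding ext_cube_def
    by (intro subgroup_free_Abelian_group_eq_carrier) (auto simp: triples_def)
  then show ?thesis
    unfolding total_milnor_quotient_def
    by (simp add: trivial_group_FactGroup_carrier ext_cube_def)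
qed

lemma increasing_triple_lt_5:
  assumes "a < b" "b < c" "c < (5::nat)"
  shows "(a, b, c) \<in> {(0, 1, 2), (0, 1, 3), (0, 1, 4), (0, 2, 3), (0, 2, 4), (0, 3, 4),
        (1, 2, 3), (1, 2, 4), (1, 3, 4), (2, 3, 4)}"
proof -
  consider "c = 0" | "c = 1" | "c = 2" | "c = 3" | "c = 4"
    using assms(3) by linarith
  then show ?thesis
    using assms(1,2) by cases (auto simp: numeral_eq_Suc less_Suc_eq)
qed

theorem theorem1p4:
  fixes \<Lambda> :: "int mat"
  assumes "\<Lambda> = mat_of_rows_list 5
    [[0, 1, 1, 0, 0],
     [1, 0, 1, 1, 0],
     [1, 1, 0, 1, 1],
     [0, 1, 1, 0, 1],
     [0, 0, 1, 1, 0]]"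
  shows "trivial_group (total_milnor_quotient \<Lambda>)"
proof -
  have dim: "dim_row \<Lambda> = 5"
    by (simp add: assms mat_of_rows_list_def)
  let ?H = "milnor_subgroup \<Lambda>"
  let ?e = "\<lambda>a b c :: nat. frag_of (a, b, c)"
  have H: "subgroup ?H (free_Abelian_group (triples 5))"
    using subgroup_milnor_subgroup[of \<Lambda>] by (simp add: dim ext_cube_def)
  note minus = subgroup_free_Abelian_group_minus[OF H]
    and add = subgroup_free_Abelian_group_add[OF H]
    and diff = subgroup_free_Abelian_group_diff[OF H]
  have gen: "milnor_vec \<Lambda> j k \<in> ?H" if "j < 5" "k < 5" "j \<noteq> k" for j k
    using milnor_vec_in_milnor_subgroup that by (simp add: dim)
  \<comment> \<open>A sum over an explicit list of indices is unfolded term by term by the simplifier.\<close>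
  have expand: "milnor_vec \<Lambda> j k = (\<Sum>i\<leftarrow>[0, 1, 2, 3, 4]. frag_cmul (\<Lambda> $$ (i, k)) (X 5 i j k))" for j k
    by (simp add: milnor_vec_def dim numeral_eq_Suc add_ac)
  have v:
    "milnor_vec \<Lambda> 2 0 = ?e 0 1 2"
    "milnor_vec \<Lambda> 3 0 = ?e 0 1 3 + ?e 0 2 3"
    "milnor_vec \<Lambda> 4 0 = ?e 0 1 4 + ?e 0 2 4"
    "milnor_vec \<Lambda> 0 1 = ?e 0 1 2 + ?e 0 1 3"
    "milnor_vec \<Lambda> 2 1 = - ?e 0 1 2 - ?e 1 2 3"
    "milnor_vec \<Lambda> 4 1 = - ?e 0 1 4 + ?e 1 2 4 + ?e 1 3 4"
    "milnor_vec \<Lambda> 1 3 = - ?e 1 2 3 + ?e 1 3 4"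
    "milnor_vec \<Lambda> 0 4 = - ?e 0 2 4 - ?e 0 3 4"
    "milnor_vec \<Lambda> 1 4 = - ?e 1 2 4 - ?e 1 3 4"
    "milnor_vec \<Lambda> 2 4 = - ?e 2 3 4"
    unfolding expand by (simp_all add: assms mat_of_rows_list_def X_sorted)
  have e012: "?e 0 1 2 \<in> ?H"
    using gen[of 2 0] by (simp add: v del: One_nat_def)
  have e234: "?e 2 3 4 \<in> ?H"
    using minus[OF gen[of 2 4]] by (simp add: v del: One_nat_def)
  have e013: "?e 0 1 3 \<in> ?H"
    using diff[OF gen[of 0 1] e012] by (simp add: v del: One_nat_def)
  have e023: "?e 0 2 3 \<in> ?H"
    using diff[OF gen[of 3 0] e013] by (simp add: v del: One_nat_def)
  have e123: "?e 1 2 3 \<in> ?H"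
    using diff[OF minus[OF gen[of 2 1]] e012] by (simp add: v del: One_nat_def)
  have e134: "?e 1 3 4 \<in> ?H"
    using add[OF gen[of 1 3] e123] by (simp add: v del: One_nat_def)
  have e124: "?e 1 2 4 \<in> ?H"
    using diff[OF minus[OF gen[of 1 4]] e134] by (simp add: v del: One_nat_def)
  have e014: "?e 0 1 4 \<in> ?H"
    using diff[OF add[OF e124 e134] gen[of 4 1]] by (simp add: v del: One_nat_def)
  have e024: "?e 0 2 4 \<in> ?H"
    using diff[OF gen[of 4 0] e014] by (simp add: v del: One_nat_def)
  have e034: "?e 0 3 4 \<in> ?H"
    using diff[OF minus[OF gen[of 0 4]] e024] by (simp add: v del: One_nat_def)
  show ?thesis
  proof (rule trivial_total_milnor_quotientI)
    fix a b c :: nat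
    assume "a < b" "b < c" "c < dim_row \<Lambda>"
    then show "frag_of (a, b, c) \<in> ?H"
      using increasing_triple_lt_5[of a b c] dim e012 e013 e014 e023 e024 e034 e123 e124 e134 e234 by auto
  qed
qed

end
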